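(* Let $\mathbb{X}$ be a reflexive Opial space, let $\mathcal{M}\subset\mathbb{X}$ be a non-empty, bounded, norm closed and convex subset, and let $f:\mathcal{M}\to\mathbb{X}$ be a mapping. Let $x_0\in\mathcal{M}$ be a starting point for the iteration $x_{n+1}=f(x_n)$, $n\ge 0$, such that the resulting sequence $\Sigma(x_0)=\{x_n\}_{n\ge 0}$ belongs to $\mathcal{M}$ (i.e. $x_n\in\mathcal{M}$ for all $n\ge0$) and is asymptotically regular, i.e. $\|x_{n+1}-x_n\|\to0$ as $n\to\infty$. Let $\mathcal{A}(x_0)$ be the set of all weak accumulation points of the sequence $\Sigma(x_0)$, and suppose that $f$ is weakly sequentially non-expansive at every point of $\mathcal{A}(x_0)$. If $\mathrm{Fix}(f)\subset\Lambda(\Sigma(x_0))$, then the entire sequence $\Sigma(x_0)$ converges weakly to a point $w\in\mathrm{Fix}(f)$, which satisfies $$\psi_{\Sigma}(w)=\min_{z\in\Lambda(\Sigma(x_0))}\psi_{\Sigma}(z)=\min_{z\in\mathrm{Fix}(f)}\psi_{\Sigma}(z),$$ where $\Sigma=\Sigma(x_0)$.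
   Context: All Banach spaces are real; the norm is denoted by $\|\cdot\|$, and $\rightharpoonup$ denotes weak convergence. Opial space: a Banach space $\mathbb{X}$ such that for every weakly convergent sequence $x_n\rightharpoonup x_\infty$ in $\mathbb{X}$ one has $\liminf_{n\to\infty}\|x_n-x_\infty\|<\liminf_{n\to\infty}\|x_n-z\|$ for all $z\in\mathbb{X}$ with $z\neq x_\infty$. Fixed point set: $\mathrm{Fix}(f)=\{x\in\mathcal{M}: f(x)=x\}$. Weak accumulation point of a sequence: a weak limit of some subsequence. Weak sequential non-expansiveness: a mapping $f:\mathcal{M}\to\mathbb{X}$ is weakly sequentially non-expansive at $y\in\mathcal{M}$ if for any sequence $\{y_n\}_n\subset\mathcal{M}$ with $y_n\rightharpoonup y$ it holds that $\liminf_{n\to\infty}\|f(y_n)-f(y)\|\le\liminf_{n\to\infty}\|y_n-y\|$. For a sequence $\Sigma=\{x_n\}_n\subset\mathbb{X}$, let $\Lambda(\Sigma):=\{z\in\mathbb{X}:\ \lim_{n\to\infty}\|x_n-z\|\text{ exists}\}$ (existence as a finite real number), and, if $\Lambda(\Sigma)\neq\emptyset$, let $\psi_\Sigma:\Lambda(\Sigma)\to[0,\infty)$, $\psi_\Sigma(z):=\lim_{n\to\infty}\|x_n-z\|$. *)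

theory Defs
  imports "HOL-Analysis.Analysis"
begin

text \<open>The dual of \<^typ>\<open>'a::real_normed_vector\<close> is \<^typ>\<open>'a \<Rightarrow>\<^sub>L real\<close> with the operator norm.\<close>

definition weakly_convergent_to :: "(nat \<Rightarrow> 'a::real_normed_vector) \<Rightarrow> 'a \<Rightarrow> bool" where
  "weakly_convergent_to x l \<longleftrightarrow>
     (\<forall>\<phi> :: 'a \<Rightarrow>\<^sub>L real. (\<lambda>n. blinfun_apply \<phi> (x n)) \<longlonglongrightarrow> blinfun_apply \<phi> l)"

text \<open>Reflexivity: the canonical embedding of the space into its bidual is onto.\<close>

definition reflexive_space :: "'a::real_normed_vector itself \<Rightarrow> bool" where
  "reflexive_space _ \<longleftrightarrow>
     (\<forall>\<Phi> :: ('a \<Rightarrow>\<^sub>L real) \<Rightarrow>\<^sub>L real. \<exists>x :: 'a. \<forall>\<phi>. blinfun_apply \<Phi> \<phi> = blinfun_apply \<phi> x)"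

text \<open>Lower limits are taken in \<^typ>\<open>ereal\<close>, so that they exist (possibly infinite) for
  unbounded sequences as well.\<close>

definition opial_space :: "'a::banach itself \<Rightarrow> bool" where
  "opial_space _ \<longleftrightarrow>
     (\<forall>(x :: nat \<Rightarrow> 'a) l. weakly_convergent_to x l \<longrightarrow>
        (\<forall>z. z \<noteq> l \<longrightarrow>
           liminf (\<lambda>n. ereal (norm (x n - l))) < liminf (\<lambda>n. ereal (norm (x n - z)))))"

text \<open>A mapping from \<open>M\<close> into the space is represented by a total function; only its values
  on \<open>M\<close> are relevant.\<close>

definition fixed_points :: "'a set \<Rightarrow> ('a \<Rightarrow> 'a) \<Rightarrow> 'a set" where
  "fixed_points M f = {x \<in> M. f x = x}"

definition weak_accumulation_points :: "(nat \<Rightarrow> 'a::real_normed_vector) \<Rightarrow> 'a set" where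
  "weak_accumulation_points x =
     {z. \<exists>r :: nat \<Rightarrow> nat. strict_mono r \<and> weakly_convergent_to (x \<circ> r) z}"

definition weakly_seq_nonexpansive_at ::
  "'a::real_normed_vector set \<Rightarrow> ('a \<Rightarrow> 'a) \<Rightarrow> 'a \<Rightarrow> bool" where
  "weakly_seq_nonexpansive_at M f y \<longleftrightarrow>
     (\<forall>u :: nat \<Rightarrow> 'a. (\<forall>n. u n \<in> M) \<longrightarrow> weakly_convergent_to u y \<longrightarrow>
        liminf (\<lambda>n. ereal (norm (f (u n) - f y))) \<le> liminf (\<lambda>n. ereal (norm (u n - y))))"

definition Lambda_set :: "(nat \<Rightarrow> 'a::real_normed_vector) \<Rightarrow> 'a set" where
  "Lambda_set x = {z. convergent (\<lambda>n. norm (x n - z))}"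

text \<open>Only meaningful for \<open>z \<in> Lambda_set x\<close>.\<close>

definition psi :: "(nat \<Rightarrow> 'a::real_normed_vector) \<Rightarrow> 'a \<Rightarrow> real" where
  "psi x z = lim (\<lambda>n. norm (x n - z))"

end

theory Submission
  imports Defs "HOL-Library.Diagonal_Subsequence"
begin

text \<open>
  Every weak accumulation point \<open>y\<close> of the iteration is a fixed point. Along a subsequence
  \<open>u\<close> with weak limit \<open>y\<close>, asymptotic regularity makes \<open>u n\<close> and \<open>f (u n)\<close>
  asymptotically equal, so weak sequential non-expansiveness says that \<open>u\<close> is asymptotically
  at least as close to \<open>f y\<close> as to \<open>y\<close>; the Opial property forbids this unless
  \<open>f y = y\<close> (\<open>weak_limit_fixed_if_asymptotically_regular\<close>). Hence \<open>y\<close> lies in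
  \<open>Lambda_set x\<close>, by the assumption on the fixed points.

  On \<open>Lambda_set x\<close> the function \<open>psi\<close> can be computed along any subsequence, so the Opial
  property along \<open>u\<close> says that \<open>y\<close> is the strict minimizer of \<open>psi x\<close> there
  (\<open>psi_less_at_accumulation_point\<close>). Strict minimizers are unique, so there is at most one
  accumulation point. Reflexivity provides weakly convergent subsequences of every bounded sequence;
  thus there is exactly one, and the whole sequence converges weakly to it.

  Two facts of functional analysis carry this: closed convex sets contain the weak limits of their
  sequences (\<open>weak_limit_in_closed_convex\<close>), and bounded sequences in a reflexive space have
  weakly convergent subsequences (\<open>reflexive_bounded_weakly_convergent_subseq\<close>). Both are
  consequences of the Hahn--Banach theorem, which is proved in the form that every sublinear
  functional dominates a linear one. The same construction, lowering a sublinear functional as far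
  as possible in the directions of a convex set, yields both this theorem and the separation of a
  point from a convex set.
\<close>

section \<open>Sublinear functionals and the Hahn--Banach theorem\<close>

definition sublinear :: "('a::real_vector \<Rightarrow> real) \<Rightarrow> bool" where
  "sublinear q \<longleftrightarrow>
     (\<forall>u v. q (u + v) \<le> q u + q v) \<and> (\<forall>c>0. \<forall>v. q (c *\<^sub>R v) = c * q v)"

lemma sublinear_add: "sublinear q \<Longrightarrow> q (u + v) \<le> q u + q v"
  and sublinear_scaleR: "sublinear q \<Longrightarrow> c > 0 \<Longrightarrow> q (c *\<^sub>R v) = c * q v"
  by (auto simp: sublinear_def)

lemma sublinear_0: "sublinear q \<Longrightarrow> q 0 = 0"
  using sublinear_scaleR[of q 2 0] by simp

lemma sublinear_scaleR_nonneg: "sublinear q \<Longrightarrow> c \<ge> 0 \<Longrightarrow> q (c *\<^sub>R v) = c * q v"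
  using sublinear_scaleR[of q c v] sublinear_0[of q] by (cases "c = 0") auto

lemma sublinear_minus: "sublinear q \<Longrightarrow> - q (- v) \<le> q v"
  using sublinear_add[of q v "- v"] sublinear_0[of q] by simp

lemma sublinearI:
  assumes "\<And>u v. q (u + v) \<le> q u + q v" and "\<And>c v. c > 0 \<Longrightarrow> q (c *\<^sub>R v) \<le> c * q v"
  shows "sublinear q"
  unfolding sublinear_def
proof (intro conjI allI impI assms(1))
  fix c :: real and v assume c: "c > 0"
  have "q v = q (inverse c *\<^sub>R c *\<^sub>R v)" using c by simp
  also have "\<dots> \<le> inverse c * q (c *\<^sub>R v)" using c by (intro assms(2)) simp
  finally have "c * q v \<le> q (c *\<^sub>R v)" using c by (simp add: field_simps)
  with assms(2)[OF c, of v] show "q (c *\<^sub>R v) = c * q v" by simp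
qed

lemma sublinear_norm: "sublinear norm"
  by (rule sublinearI) (auto simp: norm_triangle_ineq)

text \<open>
  The lowered functional is the infimum of \<open>q (v + t *\<^sub>R k) - t * c\<close> over \<open>t \<ge> 0\<close>
  and \<open>k \<in> K\<close>. The bound \<open>c \<le> q k\<close> keeps it finite, convexity of \<open>K\<close> makes
  it subadditive, and \<open>t = 1\<close> gives the new bound at \<open>- k\<close>. With \<open>K = {w}\<close> and
  \<open>c = q w\<close> it shows that minimal sublinear functionals are odd; with \<open>q = norm\<close> and the
  translates \<open>z - m\<close> of the points of a convex set it separates that set from \<open>z\<close>.
\<close>

lemma sublinear_lowering:
  assumes q: "sublinear q" and K: "convex K" "K \<noteq> {}" and c: "\<And>k. k \<in> K \<Longrightarrow> c \<le> q k"
  obtains q' where "sublinear q'" "q' \<le> q" "\<And>k. k \<in> K \<Longrightarrow> q' (- k) \<le> - c"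
proof -
  define S where "S v = {q (v + t *\<^sub>R k) - t * c | t k. 0 \<le> t \<and> k \<in> K}" for v
  define q' where "q' v = Inf (S v)" for v
  have ne: "S v \<noteq> {}" for v using K unfolding S_def by (auto intro: exI[of _ 0])
  have lower: "- q (- v) \<le> a" if "a \<in> S v" for a v
  proof -
    from that obtain t k where t: "0 \<le> t" "k \<in> K" "a = q (v + t *\<^sub>R k) - t * c"
      by (auto simp: S_def)
    have "t * c \<le> q (t *\<^sub>R k)"
      using t c by (simp add: sublinear_scaleR_nonneg[OF q] mult_left_mono)
    also have "\<dots> \<le> q (v + t *\<^sub>R k) + q (- v)"
      using sublinear_add[OF q, of "v + t *\<^sub>R k" "- v"] by simp
    finally show ?thesis using t by simp
  qed
  have bdd: "bdd_below (S v)" for v using lower by (meson bdd_belowI)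
  have le: "q' v \<le> q (v + t *\<^sub>R k) - t * c" if "0 \<le> t" "k \<in> K" for v t k
    unfolding q'_def using that bdd by (intro cInf_lower) (auto simp: S_def)
  have approx: "\<exists>t k. 0 \<le> t \<and> k \<in> K \<and> q (v + t *\<^sub>R k) - t * c < q' v + e" if "e > 0" for v e
    using cInf_lessD[OF ne, of v "q' v + e"] that by (auto simp: q'_def S_def)
  have "sublinear q'"
  proof (rule sublinearI)
    fix u v
    show "q' (u + v) \<le> q' u + q' v"
    proof (rule field_le_epsilon)
      fix e :: real assume "e > 0"
      then have "e / 2 > 0" by simp
      obtain s k where s: "0 \<le> s" "k \<in> K" "q (u + s *\<^sub>R k) - s * c < q' u + e / 2"
        using approx[OF \<open>e / 2 > 0\<close>] by blast
      obtain t l where t: "0 \<le> t" "l \<in> K" "q (v + t *\<^sub>R l) - t * c < q' v + e / 2"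
        using approx[OF \<open>e / 2 > 0\<close>] by blast
      \<comment> \<open>The weighted mean of \<open>k\<close> and \<open>l\<close> is the direction that tests the sum.\<close>
      obtain m where m: "m \<in> K" "(s + t) *\<^sub>R m = s *\<^sub>R k + t *\<^sub>R l"
      proof (cases "s + t = 0")
        case True
        then have "s = 0" "t = 0" using s t by auto
        then show ?thesis using that[of k] s by simp
      next
        case False
        then have pos: "s + t > 0" using s t by simp
        let ?m = "(s / (s + t)) *\<^sub>R k + (t / (s + t)) *\<^sub>R l"
        have "?m \<in> K"
          using s t pos by (intro convexD[OF K(1)]) (auto simp: add_divide_distrib[symmetric])
        moreover have "(s + t) *\<^sub>R ?m = s *\<^sub>R k + t *\<^sub>R l"
          using pos by (simp add: scaleR_add_right)
        ultimately show ?thesis using that by blast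
      qed
      have "q' (u + v) \<le> q (u + v + (s + t) *\<^sub>R m) - (s + t) * c"
        using s t m by (intro le) auto
      also have "u + v + (s + t) *\<^sub>R m = (u + s *\<^sub>R k) + (v + t *\<^sub>R l)"
        by (simp add: m)
      also have "q \<dots> \<le> q (u + s *\<^sub>R k) + q (v + t *\<^sub>R l)" by (rule sublinear_add[OF q])
      finally show "q' (u + v) \<le> q' u + q' v + e" using s t by (simp add: algebra_simps)
    qed
  next
    fix a :: real and v assume a: "a > 0"
    show "q' (a *\<^sub>R v) \<le> a * q' v"
    proof (rule field_le_epsilon)
      fix e :: real assume "e > 0"
      then have "e / a > 0" using a by simp
      obtain t k where t: "0 \<le> t" "k \<in> K" "q (v + t *\<^sub>R k) - t * c < q' v + e / a"
        using approx[OF \<open>e / a > 0\<close>] by blast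
      have "q' (a *\<^sub>R v) \<le> q (a *\<^sub>R v + (a * t) *\<^sub>R k) - (a * t) * c"
        using a t by (intro le) auto
      also have "\<dots> = a * (q (v + t *\<^sub>R k) - t * c)"
        using sublinear_scaleR[OF q a, of "v + t *\<^sub>R k"] by (simp add: algebra_simps)
      also have "\<dots> \<le> a * (q' v + e / a)" using a t by (intro mult_left_mono) auto
      finally show "q' (a *\<^sub>R v) \<le> a * q' v + e" using a by (simp add: algebra_simps)
    qed
  qed
  moreover have "q' \<le> q"
  proof (rule le_funI)
    fix v
    obtain k where "k \<in> K" using K by blast
    then show "q' v \<le> q v" using le[of 0 k v] by simp
  qed
  moreover have "q' (- k) \<le> - c" if "k \<in> K" for k
    using le[of 1 k "- k"] that sublinear_0[OF q] by simp
  ultimately show ?thesis using that by blast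
qed

text \<open>
  Zorn's lemma applies because the pointwise infimum of a chain below \<open>p\<close> is again sublinear:
  it is finite since \<open>q v \<ge> - q (- v) \<ge> - p (- v)\<close> for every sublinear \<open>q \<le> p\<close>, and the
  chain condition allows two approximations of the infimum to be made by the same functional.
\<close>

lemma minimal_sublinear_exists:
  assumes p: "sublinear p"
  obtains q where "sublinear q" "q \<le> p" "\<And>q'. sublinear q' \<Longrightarrow> q' \<le> q \<Longrightarrow> q' = q"
proof -
  define A where "A = {q. sublinear q \<and> q \<le> p}"
  have "\<exists>m\<in>A. \<forall>a\<in>A. a \<le> m \<longrightarrow> a = m"
  proof (rule predicate_Zorn)
    show "partial_order_on A (relation_of (\<lambda>a b. b \<le> a) A)"
      by (rule partial_order_on_relation_ofI) auto
  next
    fix C assume C: "C \<in> Chains (relation_of (\<lambda>a b. b \<le> a) A)"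
    then have CA: "C \<subseteq> A" by (auto simp: Chains_def relation_of_def)
    have chain: "a \<le> b \<or> b \<le> a" if "a \<in> C" "b \<in> C" for a b
      using C that by (auto simp: Chains_def relation_of_def)
    show "\<exists>u\<in>A. \<forall>a\<in>C. u \<le> a"
    proof (cases "C = {}")
      case True
      then show ?thesis using p by (auto simp: A_def)
    next
      case False
      define u where "u v = (INF q\<in>C. q v)" for v
      have bdd: "bdd_below ((\<lambda>q. q v) ` C)" for v
      proof (rule bdd_belowI2)
        fix q assume "q \<in> C"
        then have "sublinear q" "q \<le> p" using CA by (auto simp: A_def)
        then have "- q (- v) \<le> q v" "q (- v) \<le> p (- v)"
          by (auto simp: sublinear_minus le_funD)
        then show "- p (- v) \<le> q v" by simp
      qed
      have le: "u v \<le> q v" if "q \<in> C" for q v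
        unfolding u_def by (rule cINF_lower[OF bdd that])
      have approx: "\<exists>q\<in>C. q v < u v + e" if "e > 0" for v e
        using cINF_less_iff[OF False bdd, of v "u v + e"] that by (simp add: u_def)
      have "sublinear u"
      proof (rule sublinearI)
        fix v w
        show "u (v + w) \<le> u v + u w"
        proof (rule field_le_epsilon)
          fix e :: real assume "e > 0"
          then have e: "e / 2 > 0" by simp
          obtain a where a: "a \<in> C" "a v < u v + e / 2" using approx[OF e] by blast
          obtain b where b: "b \<in> C" "b w < u w + e / 2" using approx[OF e] by blast
          obtain d where d: "d \<in> C" "d \<le> a" "d \<le> b" using chain a b by blast
          then have "sublinear d" using CA by (auto simp: A_def)
          then have "u (v + w) \<le> d v + d w"
            using le[OF d(1), of "v + w"] sublinear_add[of d v w] by simp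
          also have "\<dots> \<le> a v + b w" using d by (simp add: add_mono le_fun_def)
          finally show "u (v + w) \<le> u v + u w + e" using a b by simp
        qed
      next
        fix c :: real and v assume c: "c > 0"
        show "u (c *\<^sub>R v) \<le> c * u v"
        proof (rule field_le_epsilon)
          fix e :: real assume "e > 0"
          then have e: "e / c > 0" using c by simp
          obtain a where a: "a \<in> C" "a v < u v + e / c" using approx[OF e] by blast
          then have "sublinear a" using CA by (auto simp: A_def)
          then have "u (c *\<^sub>R v) \<le> c * a v"
            using le[OF a(1), of "c *\<^sub>R v"] sublinear_scaleR[of a c v] c by simp
          also have "\<dots> \<le> c * (u v + e / c)" using c a by (intro mult_left_mono) auto
          finally show "u (c *\<^sub>R v) \<le> c * u v + e" using c by (simp add: algebra_simps)
        qed
      qed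
      moreover have "u \<le> p"
      proof -
        obtain q where q: "q \<in> C" using False by blast
        then have "u \<le> q" by (auto intro: le_funI le)
        also have "q \<le> p" using q CA by (auto simp: A_def)
        finally show ?thesis .
      qed
      ultimately show ?thesis using le by (auto simp: A_def le_fun_def)
    qed
  qed
  then obtain m where m: "m \<in> A" "\<And>a. a \<in> A \<Longrightarrow> a \<le> m \<Longrightarrow> a = m" by blast
  show ?thesis
  proof (rule that[of m])
    fix q' assume "sublinear q'" "q' \<le> m"
    then show "q' = m" using m by (auto simp: A_def intro: order_trans)
  qed (use m in \<open>auto simp: A_def\<close>)
qed

text \<open>
  A minimal sublinear functional is linear: lowering it in the direction of \<open>w\<close> changes nothing,
  so it is odd, and an odd subadditive functional is additive.
\<close>

theorem hahn_banach_sublinear: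
  fixes p :: "'a::real_vector \<Rightarrow> real"
  assumes "sublinear p"
  obtains g where "linear g" "\<And>v. g v \<le> p v"
proof -
  obtain g where g: "sublinear g" "g \<le> p"
    and minimal: "\<And>q'. sublinear q' \<Longrightarrow> q' \<le> g \<Longrightarrow> q' = g"
    using minimal_sublinear_exists[OF assms] by blast
  have odd: "g (- w) = - g w" for w
  proof -
    obtain q' where q': "sublinear q'" "q' \<le> g" "q' (- w) \<le> - g w"
      using sublinear_lowering[OF g(1), of "{w}" "g w"] by auto
    then have "g (- w) \<le> - g w" using minimal by blast
    then show ?thesis using sublinear_minus[OF g(1), of w] by simp
  qed
  have "linear g"
  proof (rule linearI)
    fix u v
    have "g u \<le> g (u + v) - g v"
      using sublinear_add[OF g(1), of "u + v" "- v"] by (simp add: odd)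
    then show "g (u + v) = g u + g v" using sublinear_add[OF g(1), of u v] by simp
  next
    fix c :: real and v
    show "g (c *\<^sub>R v) = c *\<^sub>R g v"
    proof (cases "c \<ge> 0")
      case True
      then show ?thesis using sublinear_scaleR_nonneg[OF g(1)] by simp
    next
      case False
      then have "g ((- c) *\<^sub>R v) = - c * g v"
        by (intro sublinear_scaleR_nonneg[OF g(1)]) simp
      then show ?thesis using odd[of "c *\<^sub>R v"] by (simp add: scaleR_minus_left)
    qed
  qed
  then show ?thesis using that g by (auto simp: le_fun_def)
qed

section \<open>Separation by bounded functionals\<close>

text \<open>
  Lowering the norm over \<open>z - M\<close> with level \<open>d\<close> gives a sublinear functional that is at
  most \<open>- d\<close> on \<open>M - z\<close>. Any linear functional below it inherits this bound, and has norm at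
  most 1 as it also lies below the norm. The number \<open>d\<close> may be any lower bound of the distances,
  so that norming functionals (\<open>M = {0}\<close>) come out with the sharp constant.
\<close>

lemma separating_functional:
  fixes M :: "'a::real_normed_vector set"
  assumes M: "convex M" "M \<noteq> {}" and d: "\<And>m. m \<in> M \<Longrightarrow> d \<le> norm (z - m)"
  obtains \<phi> :: "'a \<Rightarrow>\<^sub>L real"
  where "norm \<phi> \<le> 1" "\<And>m. m \<in> M \<Longrightarrow> blinfun_apply \<phi> m + d \<le> blinfun_apply \<phi> z"
proof -
  let ?K = "(\<lambda>m. z - m) ` M"
  have K: "convex ?K" "?K \<noteq> {}"
    using convex_translation[OF convex_negations[OF M(1)], of z] M(2) by (auto simp: image_image)
  obtain q where q: "sublinear q" "q \<le> norm" and qd: "\<And>k. k \<in> ?K \<Longrightarrow> q (- k) \<le> - d"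
    using sublinear_lowering[OF sublinear_norm K, of d] d by blast
  obtain g where g: "linear g" "\<And>v. g v \<le> q v" using hahn_banach_sublinear[OF q(1)] by blast
  have le: "g v \<le> norm v" for v using g(2)[of v] le_funD[OF q(2), of v] by simp
  have abs: "norm (g v) \<le> norm v" for v
    using le[of v] le[of "- v"] linear_neg[OF g(1), of v] by (simp add: abs_le_iff)
  have bl: "bounded_linear g"
    using g(1) abs by (intro bounded_linear_intro[of g 1]) (auto simp: linear_add linear_scale)
  show ?thesis
  proof (rule that[of "Blinfun g"])
    show "norm (Blinfun g) \<le> 1"
      by (rule norm_blinfun_bound) (auto simp: bounded_linear_Blinfun_apply[OF bl] abs[simplified])
  next
    fix m assume "m \<in> M"
    then have "g (m - z) \<le> - d" using g(2)[of "m - z"] qd[of "z - m"] by auto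
    then show "blinfun_apply (Blinfun g) m + d \<le> blinfun_apply (Blinfun g) z"
      by (simp add: bounded_linear_Blinfun_apply[OF bl] linear_diff[OF g(1)])
  qed
qed

corollary norming_functional:
  fixes z :: "'a::real_normed_vector"
  obtains \<phi> :: "'a \<Rightarrow>\<^sub>L real" where "norm \<phi> \<le> 1" "norm z \<le> blinfun_apply \<phi> z"
  using separating_functional[of "{0}" "norm z" z] by (auto simp: blinfun.zero_right)

corollary functional_separating_closed_convex:
  fixes M :: "'a::real_normed_vector set"
  assumes "convex M" "closed M" "M \<noteq> {}" "z \<notin> M"
  obtains \<phi> :: "'a \<Rightarrow>\<^sub>L real" and d :: real
  where "d > 0" "\<And>m. m \<in> M \<Longrightarrow> blinfun_apply \<phi> m + d \<le> blinfun_apply \<phi> z"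
proof -
  have "infdist z M \<le> norm (z - m)" if "m \<in> M" for m
    using infdist_le[OF that, of z] by (simp add: dist_norm)
  moreover have "infdist z M > 0"
    using assms by (simp add: infdist_pos_not_in_closed)
  ultimately show ?thesis using separating_functional[OF assms(1,3)] that by metis
qed

corollary functional_annihilating_closed_subspace:
  fixes Y :: "'a::real_normed_vector set"
  assumes Y: "subspace Y" "closed Y" and z: "z \<notin> Y"
  obtains \<phi> :: "'a \<Rightarrow>\<^sub>L real"
  where "\<And>y. y \<in> Y \<Longrightarrow> blinfun_apply \<phi> y = 0" "blinfun_apply \<phi> z \<noteq> 0"
proof -
  obtain \<phi> :: "'a \<Rightarrow>\<^sub>L real" and d where
    d: "d > 0" "\<And>m. m \<in> Y \<Longrightarrow> blinfun_apply \<phi> m + d \<le> blinfun_apply \<phi> z"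
    using functional_separating_closed_convex[OF subspace_imp_convex[OF Y(1)] Y(2) _ z]
      subspace_0[OF Y(1)] by blast
  show ?thesis
  proof (rule that)
    fix y assume y: "y \<in> Y"
    show "blinfun_apply \<phi> y = 0"
    proof (rule ccontr)
      assume n: "blinfun_apply \<phi> y \<noteq> 0"
      \<comment> \<open>This multiple of \<open>y\<close> takes the same value as \<open>z\<close>, which leaves no room for the gap \<open>d\<close>.\<close>
      let ?c = "blinfun_apply \<phi> z / blinfun_apply \<phi> y"
      have "?c *\<^sub>R y \<in> Y" using Y(1) y by (rule subspace_scale)
      from d(2)[OF this] show False using d(1) n by (simp add: blinfun.scaleR_right)
    qed
  next
    show "blinfun_apply \<phi> z \<noteq> 0"
      using d(2)[OF subspace_0[OF Y(1)]] d(1) by (simp add: blinfun.zero_right)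
  qed
qed

lemma weak_limit_in_closed_convex:
  assumes "convex M" "closed M" "\<And>n. u n \<in> M" "weakly_convergent_to u l"
  shows "l \<in> M"
proof (rule ccontr)
  assume "l \<notin> M"
  then obtain \<phi> :: "'a \<Rightarrow>\<^sub>L real" and d where
    d: "d > 0" "\<And>m. m \<in> M \<Longrightarrow> blinfun_apply \<phi> m + d \<le> blinfun_apply \<phi> l"
    using functional_separating_closed_convex[of M l] assms by blast
  have "(\<lambda>n. blinfun_apply \<phi> (u n)) \<longlonglongrightarrow> blinfun_apply \<phi> l"
    using assms(4) by (auto simp: weakly_convergent_to_def)
  then have "blinfun_apply \<phi> l \<le> blinfun_apply \<phi> l - d"
    by (rule LIMSEQ_le_const2) (use d assms(3) in \<open>auto simp: le_diff_eq\<close>)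
  then show False using d(1) by simp
qed

section \<open>Weak sequential compactness in reflexive spaces\<close>

text \<open>
  The set \<open>Q\<close> is the closure of \<open>insert 0 S\<close> under \<open>a *\<^sub>R u + v\<close> with rational
  \<open>a\<close>, obtained in countably many stages. Since the rationals are dense, continuity of the
  operations makes its topological closure a real subspace.
\<close>

lemma countable_set_in_separable_subspace:
  fixes S :: "'a::real_normed_vector set"
  assumes "countable S"
  obtains Q where "countable Q" "S \<subseteq> closure Q" "subspace (closure Q)"
proof -
  define step where "step T = (\<lambda>(a, u, v). real_of_rat a *\<^sub>R u + v) ` (UNIV \<times> T \<times> T)" for T :: "'a set"
  define Qs where "Qs n = (step ^^ n) (insert 0 S)" for n
  define Q where "Q = (\<Union>n. Qs n)"
  have Suc: "Qs (Suc n) = step (Qs n)" for n by (simp add: Qs_def)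
  have "countable (Qs n)" for n
    by (induction n) (use assms in \<open>auto simp: Suc step_def, simp add: Qs_def\<close>)
  then have count: "countable Q" by (simp add: Q_def)
  have stepI: "real_of_rat a *\<^sub>R u + v \<in> step T" if "u \<in> T" "v \<in> T" for a u v and T :: "'a set"
    using that unfolding step_def by (intro image_eqI[of _ _ "(a, u, v)"]) auto
  have "Qs n \<subseteq> Qs (Suc n)" for n
    using stepI[of _ "Qs n" _ 0] by (auto simp: Suc)
  then have mono: "Qs m \<subseteq> Qs n" if "m \<le> n" for m n using that by (rule lift_Suc_mono_le)
  have comb: "r *\<^sub>R u + v \<in> Q" if "r \<in> \<rat>" "u \<in> Q" "v \<in> Q" for r u v
  proof -
    obtain m n where "u \<in> Qs m" "v \<in> Qs n"
      using \<open>u \<in> Q\<close> \<open>v \<in> Q\<close> by (auto simp: Q_def)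
    then have "u \<in> Qs (max m n)" "v \<in> Qs (max m n)"
      using mono[of m "max m n"] mono[of n "max m n"] by auto
    then have "real_of_rat a *\<^sub>R u + v \<in> Qs (Suc (max m n))" for a
      unfolding Suc by (rule stepI)
    with \<open>r \<in> \<rat>\<close> show ?thesis unfolding Q_def Rats_def by blast
  qed
  have SQ: "insert 0 S \<subseteq> Q" using UN_upper[of 0 UNIV Qs] by (simp add: Q_def Qs_def)
  have comb_closure: "r *\<^sub>R u + v \<in> closure Q" if "u \<in> closure Q" "v \<in> closure Q" for r :: real and u v
  proof -
    have "r *\<^sub>R u + v \<in> closure Q" if "r \<in> \<rat>" "u \<in> Q" "v \<in> Q" for r u v
      using comb[OF that] closure_subset by blast
    then have "(\<lambda>(r, u, v). r *\<^sub>R u + v) ` closure (\<rat> \<times> Q \<times> Q) \<subseteq> closure Q"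
      by (intro image_closure_subset) (auto simp: case_prod_unfold intro!: continuous_intros)
    then show ?thesis using \<open>u \<in> closure Q\<close> \<open>v \<in> closure Q\<close>
      by (force simp: closure_Times Rats_closure_real image_subset_iff)
  qed
  have zero: "0 \<in> closure Q" using SQ closure_subset by blast
  have "subspace (closure Q)"
  proof (rule subspaceI)
    fix u v assume "u \<in> closure Q" "v \<in> closure Q"
    then show "u + v \<in> closure Q" using comb_closure[of u v 1] by simp
  next
    fix c u assume "u \<in> closure Q"
    then show "c *\<^sub>R u \<in> closure Q" using comb_closure[of u 0 c] zero by simp
  qed (rule zero)
  moreover have "S \<subseteq> closure Q" using SQ closure_subset by blast
  ultimately show ?thesis using that count by blast
qed

text \<open>
  The diagonal procedure fixes the tail of \<open>diagseq\<close> that starts at \<open>Suc k\<close> as a subsequence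
  of the \<open>k\<close>-th refinement; convergence is insensitive to the initial segment.
\<close>

lemma diagonal_convergent_subseq:
  fixes a :: "'i \<Rightarrow> nat \<Rightarrow> real"
  assumes D: "countable D" and bdd: "\<And>i. i \<in> D \<Longrightarrow> bounded (range (a i))"
  obtains r where "strict_mono r" "\<And>i. i \<in> D \<Longrightarrow> convergent (a i \<circ> r)"
proof (cases "D = {}")
  case True
  then show ?thesis using that[of id] by (simp add: strict_mono_def)
next
  case False
  let ?P = "\<lambda>k s. convergent (a (from_nat_into D k) \<circ> s)"
  interpret subseqs ?P
  proof
    fix k and s :: "nat \<Rightarrow> nat"
    have "bounded (range (a (from_nat_into D k) \<circ> s))"
      using bdd[OF from_nat_into[OF False, of k]] by (rule bounded_subset) auto
    then obtain l r where "strict_mono r" "((a (from_nat_into D k) \<circ> s) \<circ> r) \<longlonglongrightarrow> l"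
      using bounded_imp_convergent_subsequence by blast
    then show "\<exists>r. strict_mono r \<and> ?P k (s \<circ> r)"
      by (auto simp: convergent_def comp_assoc)
  qed
  have "convergent (a i \<circ> diagseq)" if "i \<in> D" for i
  proof -
    obtain k where k: "i = from_nat_into D k" using from_nat_into_surj[OF D \<open>i \<in> D\<close>] by metis
    have "?P k (diagseq \<circ> ((+) (Suc k)))"
      by (rule diagseq_holds) (simp add: comp_assoc[symmetric] convergent_subseq_convergent)
    then have "convergent (\<lambda>n. (a i \<circ> diagseq) (n + Suc k))"
      by (simp add: k o_def add.commute)
    then show ?thesis by (rule iffD1[OF convergent_ignore_initial_segment])
  qed
  then show ?thesis using that[OF subseq_diagseq] by blast
qed

text \<open>
  Closedness is the usual \<open>e / 3\<close> argument: on a bounded sequence, functionals that are close in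
  norm are uniformly close.
\<close>

lemma closed_subspace_convergent_functionals:
  fixes u :: "nat \<Rightarrow> 'a::real_normed_vector"
  assumes "bounded (range u)"
  defines "N \<equiv> {\<phi> :: 'a \<Rightarrow>\<^sub>L real. convergent (\<lambda>n. blinfun_apply \<phi> (u n))}"
  shows "subspace N" "closed N"
proof -
  show "subspace N"
  proof (rule subspaceI)
    fix c \<phi> assume "\<phi> \<in> N"
    then obtain l where "(\<lambda>n. blinfun_apply \<phi> (u n)) \<longlonglongrightarrow> l"
      by (auto simp: N_def convergent_def)
    from tendsto_mult_left[OF this, of c] show "c *\<^sub>R \<phi> \<in> N"
      by (auto simp: N_def convergent_def blinfun.scaleR_left)
  qed (auto simp: N_def blinfun.zero_left blinfun.add_left convergent_const intro: convergent_add)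
  obtain B where B: "B > 0" "\<And>n. norm (u n) \<le> B"
    using assms(1) by (auto simp: bounded_pos)
  have "\<phi> \<in> N" if "\<phi> \<in> closure N" for \<phi>
  proof -
    have "Cauchy (\<lambda>n. blinfun_apply \<phi> (u n))"
    proof (rule metric_CauchyI)
      fix e :: real assume e: "e > 0"
      have "e / (3 * B) > 0" using e B by simp
      then obtain \<psi> where \<psi>: "\<psi> \<in> N" "dist \<psi> \<phi> < e / (3 * B)"
        using \<open>\<phi> \<in> closure N\<close> by (meson closure_approachable)
      have close: "\<bar>blinfun_apply \<psi> (u n) - blinfun_apply \<phi> (u n)\<bar> < e / 3" for n
      proof -
        have "\<bar>blinfun_apply \<psi> (u n) - blinfun_apply \<phi> (u n)\<bar> \<le> norm (\<psi> - \<phi>) * norm (u n)"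
          using norm_blinfun[of "\<psi> - \<phi>" "u n"] by (simp add: blinfun.diff_left)
        also have "\<dots> \<le> norm (\<psi> - \<phi>) * B" using B by (intro mult_left_mono) auto
        also have "\<dots> < e / (3 * B) * B"
          using \<psi> B by (intro mult_strict_right_mono) (auto simp: dist_norm)
        finally show ?thesis using B by simp
      qed
      have "Cauchy (\<lambda>n. blinfun_apply \<psi> (u n))"
        using \<psi>(1) by (simp add: N_def convergent_Cauchy)
      then obtain n0 where n0: "\<And>m n. m \<ge> n0 \<Longrightarrow> n \<ge> n0 \<Longrightarrow>
          \<bar>blinfun_apply \<psi> (u m) - blinfun_apply \<psi> (u n)\<bar> < e / 3"
        using e metric_CauchyD[of "\<lambda>n. blinfun_apply \<psi> (u n)" "e / 3"] by (auto simp: dist_real_def)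
      show "\<exists>n0. \<forall>m\<ge>n0. \<forall>n\<ge>n0. dist (blinfun_apply \<phi> (u m)) (blinfun_apply \<phi> (u n)) < e"
      proof (intro exI[of _ n0] allI impI)
        fix m n assume "m \<ge> n0" "n \<ge> n0"
        from n0[OF this] close[of m] close[of n]
        show "dist (blinfun_apply \<phi> (u m)) (blinfun_apply \<phi> (u n)) < e"
          unfolding dist_real_def by argo
      qed
    qed
    then show ?thesis by (simp add: N_def Cauchy_convergent_iff)
  qed
  then show "closed N" using closure_subset by (auto simp: closure_subset_eq[symmetric])
qed

text \<open>
  The limit of \<open>\<phi> (u n)\<close> is a bounded linear function of \<open>\<phi>\<close>, hence evaluation at a point,
  and this point is the weak limit.
\<close>

lemma reflexive_weak_limit:
  fixes u :: "nat \<Rightarrow> 'a::real_normed_vector"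
  assumes refl: "reflexive_space TYPE('a)" and bdd: "bounded (range u)"
    and conv: "\<And>\<phi> :: 'a \<Rightarrow>\<^sub>L real. convergent (\<lambda>n. blinfun_apply \<phi> (u n))"
  obtains l where "weakly_convergent_to u l"
proof -
  obtain B where B: "B > 0" "\<And>n. norm (u n) \<le> B"
    using bdd by (auto simp: bounded_pos)
  define L where "L \<phi> = lim (\<lambda>n. blinfun_apply \<phi> (u n))" for \<phi> :: "'a \<Rightarrow>\<^sub>L real"
  have L: "(\<lambda>n. blinfun_apply \<phi> (u n)) \<longlonglongrightarrow> L \<phi>" for \<phi>
    using conv[of \<phi>] by (simp add: L_def convergent_LIMSEQ_iff)
  have bl: "bounded_linear L"
  proof (rule bounded_linear_intro[where K = B])
    fix \<phi> \<psi>
    show "L (\<phi> + \<psi>) = L \<phi> + L \<psi>"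
      using tendsto_add[OF L[of \<phi>] L[of \<psi>]] by (intro LIMSEQ_unique[OF L]) (simp add: blinfun.add_left)
  next
    fix c \<phi>
    show "L (c *\<^sub>R \<phi>) = c *\<^sub>R L \<phi>"
      using tendsto_scaleR[OF tendsto_const L[of \<phi>], of c]
      by (intro LIMSEQ_unique[OF L]) (simp add: blinfun.scaleR_left)
  next
    fix \<phi> :: "'a \<Rightarrow>\<^sub>L real"
    have "norm (blinfun_apply \<phi> (u n)) \<le> norm \<phi> * B" for n
      using norm_blinfun[of \<phi> "u n"] B(2)[of n] mult_left_mono[of "norm (u n)" B "norm \<phi>"] by simp
    then show "norm (L \<phi>) \<le> norm \<phi> * B"
      by (intro LIMSEQ_le_const2[OF tendsto_norm[OF L]]) auto
  qed
  obtain l where l: "\<And>\<phi>. blinfun_apply (Blinfun L) \<phi> = blinfun_apply \<phi> l"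
    using refl unfolding reflexive_space_def by metis
  have "L \<phi> = blinfun_apply \<phi> l" for \<phi>
    using l[of \<phi>] by (simp add: bounded_linear_Blinfun_apply[OF bl])
  then show ?thesis using L that[of l] by (simp add: weakly_convergent_to_def)
qed

text \<open>
  By the preceding lemma, it suffices to find a subsequence on which every functional converges.
  The sequence lies in a separable closed subspace \<open>closure Q\<close>, and a diagonal subsequence makes
  the norming functionals of the points of \<open>Q\<close> converge. The set \<open>N\<close> of all functionals that
  converge along it is a closed subspace of the dual. If it were proper, a non-zero element of the
  bidual would vanish on it, and by reflexivity this is evaluation at a point \<open>z\<close>. All
  functionals that annihilate \<open>closure Q\<close> belong to \<open>N\<close>, so \<open>z \<in> closure Q\<close>; but
  then \<open>z\<close> is a limit of points \<open>q \<in> Q\<close> whose norming functionals vanish at \<open>z\<close>,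
  which forces \<open>z = 0\<close>.
\<close>

theorem reflexive_bounded_weakly_convergent_subseq:
  fixes x :: "nat \<Rightarrow> 'a::real_normed_vector"
  assumes refl: "reflexive_space TYPE('a)" and bdd: "bounded (range x)"
  obtains r l where "strict_mono r" "weakly_convergent_to (x \<circ> r) l"
proof -
  obtain Q where Q: "countable Q" "range x \<subseteq> closure Q" "subspace (closure Q)"
    using countable_set_in_separable_subspace[of "range x"] by auto
  have "\<exists>\<phi> :: 'a \<Rightarrow>\<^sub>L real. norm \<phi> \<le> 1 \<and> norm y \<le> blinfun_apply \<phi> y" for y
    using norming_functional[of y] by blast
  then obtain F :: "'a \<Rightarrow> 'a \<Rightarrow>\<^sub>L real"
    where F: "\<And>y. norm (F y) \<le> 1" "\<And>y. norm y \<le> blinfun_apply (F y) y" by metis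
  have "bounded (range (\<lambda>n. blinfun_apply (F q) (x n)))" for q
    using bounded_linear_image[OF bdd blinfun.bounded_linear_right[of "F q"]] by (simp add: image_image)
  then obtain r where r: "strict_mono r"
    and rF: "\<And>q. q \<in> Q \<Longrightarrow> convergent ((\<lambda>n. blinfun_apply (F q) (x n)) \<circ> r)"
    using diagonal_convergent_subseq[OF Q(1), of "\<lambda>q n. blinfun_apply (F q) (x n)"] by blast
  have bddr: "bounded (range (x \<circ> r))" using bdd by (rule bounded_subset) auto
  define N where "N = {\<phi> :: 'a \<Rightarrow>\<^sub>L real. convergent (\<lambda>n. blinfun_apply \<phi> ((x \<circ> r) n))}"
  have N: "subspace N" "closed N"
    using closed_subspace_convergent_functionals[OF bddr] by (simp_all add: N_def)
  have "\<phi> \<in> N" for \<phi>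
  proof (rule ccontr)
    assume "\<phi> \<notin> N"
    then obtain \<Phi> :: "('a \<Rightarrow>\<^sub>L real) \<Rightarrow>\<^sub>L real"
      where \<Phi>: "\<And>\<psi>. \<psi> \<in> N \<Longrightarrow> blinfun_apply \<Phi> \<psi> = 0" "blinfun_apply \<Phi> \<phi> \<noteq> 0"
      using functional_annihilating_closed_subspace[OF N] by blast
    obtain z where z: "\<And>\<psi>. blinfun_apply \<Phi> \<psi> = blinfun_apply \<psi> z"
      using refl unfolding reflexive_space_def by blast
    have zQ: "z \<in> closure Q"
    proof (rule ccontr)
      assume "z \<notin> closure Q"
      then obtain \<psi> :: "'a \<Rightarrow>\<^sub>L real"
        where \<psi>: "\<And>y. y \<in> closure Q \<Longrightarrow> blinfun_apply \<psi> y = 0" "blinfun_apply \<psi> z \<noteq> 0"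
        using functional_annihilating_closed_subspace[OF Q(3) closed_closure] by blast
      have "blinfun_apply \<psi> (x n) = 0" for n using \<psi>(1) Q(2) by auto
      then have "\<psi> \<in> N" by (simp add: N_def convergent_const)
      then show False using \<Phi>(1) \<psi>(2) z by metis
    qed
    have "norm z \<le> 0 + e" if "e > 0" for e
    proof -
      obtain q where q: "q \<in> Q" "dist q z < e / 2"
        using zQ \<open>e > 0\<close> by (meson closure_approachable half_gt_zero)
      have "F q \<in> N" using rF[OF q(1)] by (simp add: N_def o_def)
      then have "blinfun_apply (F q) z = 0" using \<Phi>(1) z by metis
      then have "norm q \<le> blinfun_apply (F q) (q - z)" using F(2)[of q] by (simp add: blinfun.diff_right)
      also have "\<dots> \<le> norm (F q) * norm (q - z)"
        using norm_blinfun[of "F q" "q - z"] by simp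
      also have "\<dots> \<le> norm (q - z)" using F(1) by (simp add: mult_left_le_one_le)
      finally have "norm q < e / 2" using q(2) by (simp add: dist_norm)
      then show ?thesis using q(2) norm_triangle_sub[of z q] by (simp add: dist_norm norm_minus_commute)
    qed
    then have "norm z \<le> 0" by (rule field_le_epsilon)
    then show False using \<Phi>(2) z by (simp add: blinfun.zero_right)
  qed
  then obtain l where "weakly_convergent_to (x \<circ> r) l"
    using reflexive_weak_limit[OF refl bddr] unfolding N_def by blast
  with r show ?thesis using that by blast
qed

text \<open>
  If some functional kept a subsequence away from its value at \<open>w\<close>, that subsequence would
  still have a weakly convergent subsequence, necessarily with limit \<open>w\<close>.
\<close>

lemma weakly_convergent_if_unique_accumulation_point:
  fixes x :: "nat \<Rightarrow> 'a::real_normed_vector"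
  assumes refl: "reflexive_space TYPE('a)" and bdd: "bounded (range x)"
    and A: "weak_accumulation_points x \<subseteq> {w}"
  shows "weakly_convergent_to x w"
proof (rule ccontr)
  assume "\<not> weakly_convergent_to x w"
  then obtain \<phi> :: "'a \<Rightarrow>\<^sub>L real"
    where "\<not> (\<lambda>n. blinfun_apply \<phi> (x n)) \<longlonglongrightarrow> blinfun_apply \<phi> w"
    by (auto simp: weakly_convergent_to_def)
  then obtain e where e: "e > 0"
    "\<not> (\<forall>\<^sub>F n in sequentially. dist (blinfun_apply \<phi> (x n)) (blinfun_apply \<phi> w) < e)"
    by (auto simp: tendsto_iff)
  define S where "S = {n. \<not> dist (blinfun_apply \<phi> (x n)) (blinfun_apply \<phi> w) < e}"
  have "infinite S" using e(2) by (simp add: S_def eventually_cofinite cofinite_eq_sequentially[symmetric])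
  then obtain r :: "nat \<Rightarrow> nat" where r: "strict_mono r" "\<And>n. r n \<in> S"
    using infinite_enumerate by blast
  have "bounded (range (x \<circ> r))" using bdd by (rule bounded_subset) auto
  then obtain s l where s: "strict_mono s" "weakly_convergent_to ((x \<circ> r) \<circ> s) l"
    using reflexive_bounded_weakly_convergent_subseq[OF refl] by blast
  have "l \<in> weak_accumulation_points x"
    using s r(1) unfolding weak_accumulation_points_def
    by (auto simp: comp_assoc intro: strict_mono_o)
  then have "l = w" using A by blast
  then have "(\<lambda>n. blinfun_apply \<phi> (x (r (s n)))) \<longlonglongrightarrow> blinfun_apply \<phi> w"
    using s(2) by (simp add: weakly_convergent_to_def)
  then have "\<forall>\<^sub>F n in sequentially. dist (blinfun_apply \<phi> (x (r (s n)))) (blinfun_apply \<phi> w) < e"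
    using e(1) by (rule tendstoD)
  then obtain n where "dist (blinfun_apply \<phi> (x (r (s n)))) (blinfun_apply \<phi> w) < e"
    using eventually_happens'[OF sequentially_bot] by blast
  then show False using r(2)[of "s n"] by (simp add: S_def)
qed

section \<open>Accumulation points of the iteration\<close>

text \<open>
  If \<open>f y \<noteq> y\<close>, the Opial property makes the lower limit of \<open>norm (u n - f y)\<close> strictly
  larger than that of \<open>norm (u n - y)\<close>, while the triangle inequality through \<open>f (u n)\<close> and
  the non-expansiveness at \<open>y\<close> bound it by the latter.
\<close>

lemma weak_limit_fixed_if_asymptotically_regular:
  fixes u :: "nat \<Rightarrow> 'a::banach"
  assumes opial: "opial_space TYPE('a)"
    and u: "\<And>n. u n \<in> M" "weakly_convergent_to u y"
    and reg: "(\<lambda>n. norm (f (u n) - u n)) \<longlonglongrightarrow> 0"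
    and f: "weakly_seq_nonexpansive_at M f y"
  shows "f y = y"
proof (rule ccontr)
  assume "f y \<noteq> y"
  have "liminf (\<lambda>n. ereal (norm (u n - f y)))
      \<le> liminf (\<lambda>n. ereal (norm (f (u n) - u n)) + ereal (norm (f (u n) - f y)))"
  proof (intro Liminf_mono always_eventually allI)
    fix n
    have "norm (u n - f y) \<le> norm (f (u n) - u n) + norm (f (u n) - f y)"
      using norm_triangle_ineq4[of "f (u n) - f y" "f (u n) - u n"] by simp
    then show "ereal (norm (u n - f y)) \<le> ereal (norm (f (u n) - u n)) + ereal (norm (f (u n) - f y))"
      by simp
  qed
  also have "\<dots> = ereal 0 + liminf (\<lambda>n. ereal (norm (f (u n) - f y)))"
    using reg by (intro ereal_liminf_lim_add) auto
  also have "\<dots> \<le> liminf (\<lambda>n. ereal (norm (u n - y)))"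
    using f u by (auto simp: weakly_seq_nonexpansive_at_def)
  also have "\<dots> < liminf (\<lambda>n. ereal (norm (u n - f y)))"
    using opial u(2) \<open>f y \<noteq> y\<close> by (auto simp: opial_space_def)
  finally show False by simp
qed

text \<open>
  For points of \<open>Lambda_set x\<close> the lower limits in the Opial inequality are limits of the whole
  sequence, so an inequality along one subsequence compares the values of \<open>psi\<close>.
\<close>

lemma psi_less_at_accumulation_point:
  fixes x :: "nat \<Rightarrow> 'a::banach"
  assumes opial: "opial_space TYPE('a)" and y: "y \<in> weak_accumulation_points x"
    and L: "y \<in> Lambda_set x" "z \<in> Lambda_set x" and "z \<noteq> y"
  shows "psi x y < psi x z"
proof -
  obtain r where r: "strict_mono r" "weakly_convergent_to (x \<circ> r) y"
    using y by (auto simp: weak_accumulation_points_def)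
  have "liminf (\<lambda>n. ereal (norm ((x \<circ> r) n - v))) = ereal (psi x v)" if "v \<in> Lambda_set x" for v
  proof -
    have "(\<lambda>n. norm (x n - v)) \<longlonglongrightarrow> psi x v"
      using that by (simp add: Lambda_set_def psi_def convergent_LIMSEQ_iff)
    from LIMSEQ_subseq_LIMSEQ[OF this r(1)]
    show ?thesis by (intro lim_imp_Liminf) (auto simp: o_def)
  qed
  moreover have "liminf (\<lambda>n. ereal (norm ((x \<circ> r) n - y))) < liminf (\<lambda>n. ereal (norm ((x \<circ> r) n - z)))"
    using opial r(2) \<open>z \<noteq> y\<close> unfolding opial_space_def by blast
  ultimately show ?thesis using L by simp
qed

theorem theorem3p6:
  fixes M :: "'a::banach set" and f :: "'a \<Rightarrow> 'a" and x :: "nat \<Rightarrow> 'a" and x0 :: 'a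
  assumes "reflexive_space TYPE('a)" and "opial_space TYPE('a)"
    and "M \<noteq> {}" and "bounded M" and "closed M" and "convex M"
    and "x0 \<in> M" and "x 0 = x0" and "\<And>n. x (Suc n) = f (x n)"
    and "\<And>n. x n \<in> M"
    and "(\<lambda>n. norm (x (Suc n) - x n)) \<longlonglongrightarrow> 0"
    and "\<And>y. y \<in> weak_accumulation_points x \<Longrightarrow> weakly_seq_nonexpansive_at M f y"
    and "fixed_points M f \<subseteq> Lambda_set x"
  shows "\<exists>w \<in> fixed_points M f.
           weakly_convergent_to x w \<and>
           is_arg_min (psi x) (\<lambda>z. z \<in> Lambda_set x) w \<and>
           is_arg_min (psi x) (\<lambda>z. z \<in> fixed_points M f) w"
proof -
  have bdd: "bounded (range x)" using assms(4) by (rule bounded_subset) (use assms(10) in auto)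
  have fixed: "y \<in> fixed_points M f" if y: "y \<in> weak_accumulation_points x" for y
  proof -
    obtain r where r: "strict_mono r" "weakly_convergent_to (x \<circ> r) y"
      using y by (auto simp: weak_accumulation_points_def)
    have M: "(x \<circ> r) n \<in> M" for n using assms(10) by simp
    have "y \<in> M" using weak_limit_in_closed_convex[OF assms(6,5) M r(2)] .
    moreover have "(\<lambda>n. norm (f ((x \<circ> r) n) - (x \<circ> r) n)) \<longlonglongrightarrow> 0"
      using LIMSEQ_subseq_LIMSEQ[OF assms(11) r(1)] by (simp add: o_def assms(9))
    ultimately show ?thesis
      using weak_limit_fixed_if_asymptotically_regular[OF assms(2) M r(2) _ assms(12)[OF y]]
      by (simp add: fixed_points_def)
  qed
  obtain w where w: "w \<in> weak_accumulation_points x"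
    using reflexive_bounded_weakly_convergent_subseq[OF assms(1) bdd]
    unfolding weak_accumulation_points_def by blast
  have less: "psi x y < psi x z"
    if "y \<in> weak_accumulation_points x" "z \<in> Lambda_set x" "z \<noteq> y" for y z
    using psi_less_at_accumulation_point[OF assms(2) that(1) _ that(2,3)] fixed[OF that(1)] assms(13)
    by blast
  have "weak_accumulation_points x \<subseteq> {w}"
  proof
    fix y assume y: "y \<in> weak_accumulation_points x"
    have "y \<in> Lambda_set x" "w \<in> Lambda_set x" using fixed[OF y] fixed[OF w] assms(13) by auto
    then show "y \<in> {w}" using less[OF y, of w] less[OF w, of y] by force
  qed
  then have "weakly_convergent_to x w"
    by (rule weakly_convergent_if_unique_accumulation_point[OF assms(1) bdd])
  moreover have "psi x w \<le> psi x z" if "z \<in> Lambda_set x" for z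
    using less[OF w that] by (cases "z = w") auto
  ultimately show ?thesis
    using fixed[OF w] assms(13) by (auto simp: is_arg_min_linorder)
qed

end
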